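(* Let $A\in\mathfrak g$ have characteristic polynomial equal to a power of an irreducible polynomial. Unless $\mathfrak g=\mathfrak o$ and the characteristic polynomial of $A$ is $x^n$, one has $Q_A\subseteq R_A$. In the remaining case ($\mathfrak g=\mathfrak o$, characteristic polynomial $x^n$), every $v\in Q_A$ still satisfies $\langle A^kv,v\rangle=0$ for all $k\ge1$.
   Context: $\mathbb{K}=\mathbb{F}$ or a quadratic extension of a field $\mathbb{F}$ of characteristic $\neq2$; $V$ an $n$-dimensional $\mathbb{K}$-space with a non-degenerate form which is symmetric ($\mathfrak g=\mathfrak o$), Hermitian ($\mathfrak g=\mathfrak u$) or symplectic ($\mathfrak g=\mathfrak{sp}$); $\mathfrak g=\{A:A^*=-A\}$. $\phi_v$ denotes $u\mapsto\langle u,v\rangle v$. For $A\in\mathfrak g$: $R_A=\{v\in V:\langle A^kv,v\rangle=0\ \forall k\ge0\}$; in the cases $\mathfrak u,\mathfrak{sp}$, $Q_A=\{v\in V:\phi_v\in[A,\mathfrak g]\}$, and in the case $\mathfrak o$, $Q_A=\{v\in V: A\phi_v+\phi_vA\in[A,\mathfrak g]\}$, where $[A,\mathfrak g]=\{AB-BA:B\in\mathfrak g\}$. *)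

theory Defs
  imports "HOL-Analysis.Analysis" "HOL-Computational_Algebra.Polynomial"
begin

(* V = K^n (K = 'a :: field, n = CARD('n)); endomorphisms of V are n x n matrices.
   sigma is the involution of K (identity when K = F; the nontrivial automorphism of the
   quadratic extension K/F in the unitary case, F being its fixed field). *)

datatype form_class = Orth | Unit | Symp

definition field_involution :: "('a::field \<Rightarrow> 'a) \<Rightarrow> bool" where
  "field_involution \<sigma> \<longleftrightarrow>
     (\<forall>x y. \<sigma> (x + y) = \<sigma> x + \<sigma> y) \<and> (\<forall>x y. \<sigma> (x * y) = \<sigma> x * \<sigma> y) \<and>
     (\<forall>x. \<sigma> (\<sigma> x) = x)"

(* sesquilinear (linear in the first, sigma-semilinear in the second argument),
   non-degenerate form of the given class *)
definition good_form :: "form_class \<Rightarrow> ('a::field \<Rightarrow> 'a) \<Rightarrow> ('a^'n \<Rightarrow> 'a^'n \<Rightarrow> 'a) \<Rightarrow> bool" where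
  "good_form c \<sigma> B \<longleftrightarrow>
     field_involution \<sigma> \<and>
     (\<forall>u w v. B (u + w) v = B u v + B w v) \<and>
     (\<forall>a u v. B (a *s u) v = a * B u v) \<and>
     (\<forall>u v w. B u (v + w) = B u v + B u w) \<and>
     (\<forall>a u v. B u (a *s v) = \<sigma> a * B u v) \<and>
     (\<forall>v. (\<forall>u. B u v = 0) \<longrightarrow> v = 0) \<and>
     (case c of
        Orth \<Rightarrow> \<sigma> = id \<and> (\<forall>u v. B v u = B u v)
      | Unit \<Rightarrow> \<sigma> \<noteq> id \<and> (\<forall>u v. B v u = \<sigma> (B u v))
      | Symp \<Rightarrow> \<sigma> = id \<and> (\<forall>u v. B v u = - B u v))"

(* g = {A : A^* = -A}, i.e. <Au,v> = -<u,Av> for all u v *)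
definition lie_alg :: "('a::field^'n \<Rightarrow> 'a^'n \<Rightarrow> 'a) \<Rightarrow> ('a^'n^'n) set" where
  "lie_alg B = {A. \<forall>u v. B (A *v u) v = - B u (A *v v)}"

(* [A, g] *)
definition comm_set :: "('a::field^'n \<Rightarrow> 'a^'n \<Rightarrow> 'a) \<Rightarrow> 'a^'n^'n \<Rightarrow> ('a^'n^'n) set" where
  "comm_set B A = {A ** C - C ** A | C. C \<in> lie_alg B}"

(* matrix of phi_v : u \<mapsto> <u,v> v *)
definition phi :: "('a::field^'n \<Rightarrow> 'a^'n \<Rightarrow> 'a) \<Rightarrow> 'a^'n \<Rightarrow> 'a^'n^'n" where
  "phi B v = (\<chi> i j. B (axis j 1) v * v $ i)"

definition R_set :: "('a::field^'n \<Rightarrow> 'a^'n \<Rightarrow> 'a) \<Rightarrow> 'a^'n^'n \<Rightarrow> ('a^'n) set" where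
  "R_set B A = {v. \<forall>k::nat. B (((*v) A ^^ k) v) v = 0}"

definition Q_set :: "form_class \<Rightarrow> ('a::field^'n \<Rightarrow> 'a^'n \<Rightarrow> 'a) \<Rightarrow> 'a^'n^'n \<Rightarrow> ('a^'n) set" where
  "Q_set c B A =
     (if c = Orth then {v. A ** phi B v + phi B v ** A \<in> comm_set B A}
      else {v. phi B v \<in> comm_set B A})"

definition charpoly :: "'a::field^'n^'n \<Rightarrow> 'a poly" where
  "charpoly A = det (mat [:0, 1:] - (\<chi> i j. [:A $ i $ j:]))"

end

theory Submission
  imports Defs "HOL-Computational_Algebra.Polynomial_Factorial"
begin

text \<open>
  The trace pairing satisfies \<open>tr (\<phi>\<^sub>v X) = \<langle>Xv, v\<rangle>\<close>, and \<open>[A, g]\<close> is trace-orthogonal to every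
  \<open>X\<close> commuting with \<open>A\<close>, because \<open>tr ([A, C] X) = tr (C [X, A])\<close>. Outside the orthogonal case,
  \<open>X = A\<^sup>k\<close> gives \<open>\<langle>A\<^sup>k v, v\<rangle> = 0\<close> for \<open>v \<in> Q\<^sub>A\<close> at once. In the orthogonal case
  \<open>tr ((A \<phi>\<^sub>v + \<phi>\<^sub>v A) X) = 2 \<langle>XAv, v\<rangle>\<close>, so \<open>X = A\<^bsup>k-1\<^esup>\<close> handles \<open>k \<ge> 1\<close> and \<open>X = A\<^bsup>-1\<^esup>\<close>
  handles \<open>k = 0\<close>; \<open>A\<close> is invertible unless \<open>x\<close> divides its characteristic polynomial, which,
  being a power of an irreducible, is then \<open>x\<^sup>n\<close>.
\<close>

lemma det_uminus: "det (- A :: 'a::comm_ring_1^'n^'n) = (-1) ^ CARD('n) * det A"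
proof -
  have "- A = mat (-1) ** A"
    by (auto simp: vec_eq_iff matrix_matrix_mult_def mat_def if_distrib if_distribR
        sum.delta'[OF finite] cong: if_cong)
  moreover have "det (mat (-1) :: 'a^'n^'n) = (-1) ^ CARD('n)"
    by (simp add: det_diagonal mat_def)
  ultimately show ?thesis by (simp add: det_mul)
qed

lemma charpoly_matrix_entry:
  "(mat [:0, 1:] - (\<chi> i j. [:(A :: 'a::field^'n^'n) $ i $ j:])) $ i $ j
     = [:- A $ i $ j, if i = j then 1 else 0:]"
  by (simp add: mat_def)

lemma poly_charpoly_0: "poly (charpoly A) 0 = det (- A)"
  unfolding charpoly_def det_def charpoly_matrix_entry
  by (simp add: poly_sum poly_prod of_int_poly)

lemma coeff_charpoly_CARD: "coeff (charpoly (A :: 'a::field^'n^'n)) CARD('n) = 1"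
proof -
  let ?t = "\<lambda>p. of_int (sign p) * (\<Prod>i\<in>UNIV. [:- A $ i $ p i, if i = p i then 1 else 0:])"
  let ?P = "{p. p permutes (UNIV :: 'n set)}"
  have low_degree: "coeff (?t p) CARD('n) = 0" if p: "p \<in> ?P - {id}" for p
  proof -
    obtain k where k: "p k \<noteq> k" using p by (auto simp: fun_eq_iff)
    have "degree (?t p) \<le> degree (\<Prod>i\<in>UNIV. [:- A $ i $ p i, if i = p i then 1 else 0:])"
      using degree_mult_le[of "of_int (sign p)"] by simp
    also have "\<dots> \<le> (\<Sum>i\<in>UNIV. degree [:- A $ i $ p i, if i = p i then 1 else 0:])"
      using degree_prod_sum_le[of UNIV "\<lambda>i. [:- A $ i $ p i, if i = p i then 1 else 0:]"]
      unfolding o_def by (meson finite)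
    also have "\<dots> \<le> (\<Sum>i\<in>UNIV. if i = p i then 1 else 0)"
      by (rule sum_mono) auto
    also have "\<dots> < (\<Sum>i\<in>(UNIV :: 'n set). 1)"
      by (rule sum_strict_mono_ex1) (use k in \<open>auto intro!: exI[of _ k]\<close>)
    finally show ?thesis by (simp add: coeff_eq_0)
  qed
  have degree_diagonal: "degree (\<Prod>i\<in>UNIV. [:- A $ i $ i, 1:]) = CARD('n)"
    by (subst degree_prod_eq_sum_degree) auto
  have "coeff (?t id) CARD('n) = 1"
    by (simp add: sign_id lead_coeff_prod flip: degree_diagonal)
  moreover have "coeff (charpoly A) CARD('n)
      = coeff (?t id) CARD('n) + (\<Sum>p\<in>?P - {id}. coeff (?t p) CARD('n))"
    unfolding charpoly_def det_def charpoly_matrix_entry coeff_sum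
    by (rule sum.remove) (simp_all add: finite_permutations permutes_id)
  ultimately show ?thesis using low_degree by simp
qed

lemma irreducible_power_eq_monomial:
  fixes p :: "'a::field poly"
  assumes p: "irreducible p" and root: "poly (p ^ k) 0 = 0" and monic: "coeff (p ^ k) n = 1"
  shows "p ^ k = [:0, 1:] ^ n"
proof -
  have prime_X: "prime_elem ([:0, 1:] :: 'a poly)"
    using prime_elem_linear_field_poly[of 1 0] by simp
  then have "[:0, 1:] dvd p"
    using root prime_elem_dvd_power by (auto simp: dvd_iff_poly_eq_0)
  then obtain q where q: "p = [:0, 1:] * q" ..
  then have "is_unit q"
    using p prime_X by (meson irreducibleD prime_elem_def)
  then obtain d where "p = smult d [:0, 1:]"
    using q is_unit_poly_iff[of q] by auto
  then have pk: "p ^ k = monom (d ^ k) k"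
    by (simp only: monom_altdef smult_power)
  then have "k = n" and "d ^ k = 1"
    using monic by (auto split: if_splits)
  then show ?thesis
    using pk by (simp add: monom_altdef)
qed

lemma charpoly_eq_monomial_if_singular:
  fixes A :: "'a::field^'n^'n"
  assumes "irreducible p" and "charpoly A = p ^ k" and "det A = 0"
  shows "charpoly A = [:0, 1:] ^ CARD('n)"
proof -
  have "poly (p ^ k) 0 = 0"
    using assms by (metis poly_charpoly_0 det_uminus mult_zero_right)
  then show ?thesis
    using assms irreducible_power_eq_monomial[of p k "CARD('n)"] coeff_charpoly_CARD[of A] by simp
qed

lemma matrix_add_rdistrib: "((P :: 'a::semiring_1^'n^'m) + Q) ** X = P ** X + Q ** X"
  by (simp add: vec_eq_iff matrix_matrix_mult_def distrib_right sum.distrib)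

lemma matrix_diff_rdistrib: "((P :: 'a::ring_1^'n^'m) - Q) ** X = P ** X - Q ** X"
  by (simp add: vec_eq_iff matrix_matrix_mult_def left_diff_distrib sum_subtractf)

lemma trace_commutator_mult_commuting:
  fixes A C X :: "'a::comm_ring_1^'n^'n"
  assumes "A ** X = X ** A"
  shows "trace ((A ** C - C ** A) ** X) = 0"
proof -
  have "trace (A ** (C ** X)) = trace (C ** (X ** A))"
    by (subst trace_mul_sym) (simp only: matrix_mul_assoc)
  also have "\<dots> = trace (C ** (A ** X))"
    by (simp only: assms)
  finally have "trace (A ** (C ** X)) = trace (C ** (A ** X))" .
  then show ?thesis
    by (simp add: matrix_diff_rdistrib trace_sub matrix_mul_assoc)
qed

lemma trace_anticommutator_mult_commuting:
  fixes A P X :: "'a::comm_ring_1^'n^'n"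
  assumes "A ** X = X ** A"
  shows "trace ((A ** P + P ** A) ** X) = 2 * trace (P ** (X ** A))"
proof -
  have "trace ((A ** P + P ** A) ** X) = trace (A ** (P ** X)) + trace (P ** (A ** X))"
    by (simp only: matrix_add_rdistrib trace_add matrix_mul_assoc)
  also have "trace (A ** (P ** X)) = trace (P ** (X ** A))"
    by (subst trace_mul_sym) (simp only: matrix_mul_assoc)
  finally show ?thesis
    by (simp only: assms mult_2)
qed

lemma trace_phi_mult:
  fixes B :: "'a::field^'n \<Rightarrow> 'a^'n \<Rightarrow> 'a"
  assumes add: "\<forall>u w v. B (u + w) v = B u v + B w v"
    and hom: "\<forall>a u v. B (a *s u) v = a * B u v"
  shows "trace (phi B v ** X) = B (X *v v) v"
proof -
  interpret additive "\<lambda>u. B u v"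
    using add by unfold_locales blast
  have "B (X *v v) v = B (\<Sum>j\<in>UNIV. (X *v v) $ j *s axis j 1) v"
    by (simp add: basis_expansion)
  also have "\<dots> = (\<Sum>j\<in>UNIV. \<Sum>i\<in>UNIV. X $ j $ i * v $ i * B (axis j 1) v)"
    by (simp add: sum hom matrix_vector_mult_def sum_distrib_right)
  also have "\<dots> = trace (phi B v ** X)"
    by (subst sum.swap) (simp add: trace_def phi_def matrix_matrix_mult_def mult_ac)
  finally show ?thesis ..
qed

lemma trace_phi_good_form:
  assumes "good_form c \<sigma> B"
  shows "trace (phi B v ** X) = B (X *v v) v"
  using assms unfolding good_form_def by (elim conjE) (rule trace_phi_mult)

fun matrix_power :: "'a::semiring_1^'n^'n \<Rightarrow> nat \<Rightarrow> 'a^'n^'n" where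
  "matrix_power A 0 = mat 1"
| "matrix_power A (Suc k) = A ** matrix_power A k"

lemma matrix_power_mult_vector: "matrix_power A k *v v = ((*v) A ^^ k) v"
  by (induction k) (simp_all flip: matrix_vector_mul_assoc)

lemma matrix_power_commute: "A ** matrix_power A k = matrix_power A k ** A"
  by (induction k) (simp_all add: matrix_mul_assoc)

lemma Q_set_form_eq_0:
  assumes form: "good_form c \<sigma> B" and "c \<noteq> Orth" and v: "v \<in> Q_set c B A"
    and AX: "A ** X = X ** A"
  shows "B (X *v v) v = 0"
proof -
  obtain C where "phi B v = A ** C - C ** A"
    using assms by (auto simp: Q_set_def comm_set_def)
  then have "trace (phi B v ** X) = 0"
    using trace_commutator_mult_commuting[OF AX] by simp
  then show ?thesis
    by (simp only: trace_phi_good_form[OF form])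
qed

lemma Q_set_Orth_form_eq_0:
  fixes B :: "'a::field^'n \<Rightarrow> 'a^'n \<Rightarrow> 'a"
  assumes "(2::'a) \<noteq> 0" and form: "good_form Orth \<sigma> B"
    and v: "v \<in> Q_set Orth B A" and AX: "A ** X = X ** A"
  shows "B ((X ** A) *v v) v = 0"
proof -
  obtain C where C: "A ** phi B v + phi B v ** A = A ** C - C ** A"
    using v by (auto simp: Q_set_def comm_set_def)
  have "2 * B ((X ** A) *v v) v = trace ((A ** phi B v + phi B v ** A) ** X)"
    by (simp only: trace_anticommutator_mult_commuting[OF AX] trace_phi_good_form[OF form])
  also have "\<dots> = 0"
    unfolding C by (rule trace_commutator_mult_commuting[OF AX])
  finally show ?thesis
    using assms(1) by simp
qed

lemma Q_set_subset_R_set: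
  assumes "good_form c \<sigma> B" and "c \<noteq> Orth"
  shows "Q_set c B A \<subseteq> R_set B A"
proof
  fix v assume "v \<in> Q_set c B A"
  then have "B (matrix_power A k *v v) v = 0" for k
    using Q_set_form_eq_0[OF assms _ matrix_power_commute] by blast
  then show "v \<in> R_set B A"
    by (simp add: R_set_def flip: matrix_power_mult_vector)
qed

lemma Q_set_Orth_power_form_eq_0:
  fixes B :: "'a::field^'n \<Rightarrow> 'a^'n \<Rightarrow> 'a"
  assumes "(2::'a) \<noteq> 0" and "good_form Orth \<sigma> B"
    and "v \<in> Q_set Orth B A" and "k \<ge> 1"
  shows "B (((*v) A ^^ k) v) v = 0"
proof -
  obtain m where "k = Suc m"
    using \<open>k \<ge> 1\<close> by (cases k) auto
  then have "((*v) A ^^ k) v = (matrix_power A m ** A) *v v"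
    by (simp only: matrix_power_mult_vector[symmetric] matrix_power.simps matrix_power_commute)
  then show ?thesis
    using Q_set_Orth_form_eq_0[OF assms(1-3) matrix_power_commute] by simp
qed

lemma Q_set_Orth_subset_R_set:
  fixes B :: "'a::field^'n \<Rightarrow> 'a^'n \<Rightarrow> 'a"
  assumes "(2::'a) \<noteq> 0" and form: "good_form Orth \<sigma> B" and "det A \<noteq> 0"
  shows "Q_set Orth B A \<subseteq> R_set B A"
proof
  fix v assume v: "v \<in> Q_set Orth B A"
  obtain X where AX: "A ** X = mat 1"
    using \<open>det A \<noteq> 0\<close> invertible_det_nz invertible_right_inverse by blast
  then have XA: "X ** A = mat 1"
    using matrix_left_right_inverse by blast
  have "B v v = 0"
    using Q_set_Orth_form_eq_0[OF assms(1,2) v, of X] AX XA by simp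
  then have "B (((*v) A ^^ k) v) v = 0" for k
    using Q_set_Orth_power_form_eq_0[OF assms(1,2) v] by (cases "k = 0") simp_all
  then show "v \<in> R_set B A"
    by (simp add: R_set_def)
qed

theorem theorem8p3:
  fixes c :: form_class and \<sigma> :: "'a::field \<Rightarrow> 'a"
    and B :: "'a^'n \<Rightarrow> 'a^'n \<Rightarrow> 'a" and A :: "'a^'n^'n"
  assumes char: "(2::'a) \<noteq> 0"
    and form: "good_form c \<sigma> B"
    and A: "A \<in> lie_alg B"
    and irr: "\<exists>p k. irreducible p \<and> charpoly A = p ^ k"
  shows "(\<not> (c = Orth \<and> charpoly A = [:0, 1:] ^ CARD('n)) \<longrightarrow> Q_set c B A \<subseteq> R_set B A)
       \<and> (c = Orth \<and> charpoly A = [:0, 1:] ^ CARD('n) \<longrightarrow>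
            (\<forall>v\<in>Q_set c B A. \<forall>k::nat. k \<ge> 1 \<longrightarrow> B (((*v) A ^^ k) v) v = 0))"
proof (cases "c = Orth")
  case True
  have "det A \<noteq> 0" if "charpoly A \<noteq> [:0, 1:] ^ CARD('n)"
    using irr that charpoly_eq_monomial_if_singular by blast
  then show ?thesis
    using Q_set_Orth_subset_R_set[OF char] Q_set_Orth_power_form_eq_0[OF char] form True
    by blast
next
  case False
  then show ?thesis
    using Q_set_subset_R_set[OF form] by blast
qed

end
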